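(* Let $G_1=(V,E)$ and $G_2=(V',E')$ be (not necessarily connected) finite simple graphs with nonempty vertex sets such that $V\cap V'=\emptyset$, and let $n=|V|+|V'|$. Let $G_1+G_2$ be the join of $G_1$ and $G_2$, and let $N(\mathcal{P}_{G_1+G_2})$ be the number of facets of its symmetric edge polytope. Then $$3\cdot 2^{\frac{n-1}{2}}-2 \le N(\mathcal{P}_{G_1+G_2}) \le 6^{\frac{n-1}{2}}$$ if $n$ is odd, and $$2^{\frac{n}{2}+1}-2 \le N(\mathcal{P}_{G_1+G_2}) \le 14\cdot 6^{\frac{n}{2}-2}$$ if $n$ is even.
   Context: For a finite simple graph $G$ with vertex set $V$ and edge set $E(G)$, the symmetric edge polytope $\mathcal{P}_G$ is the convex hull in $\mathbb{R}^V$ of $\{\pm(\mathbf{e}_i-\mathbf{e}_j) : \{i,j\}\in E(G)\}$, where $\mathbf{e}_i$ is the $i$-th unit coordinate vector. (If $G$ is connected with $n$ vertices, $\mathcal{P}_G$ has dimension $n-1$.) $N(\mathcal{P})$ denotes the number of facets (faces of dimension $\dim\mathcal{P}-1$) of a polytope $\mathcal{P}$. The join $G_1+G_2$ of graphs $G_1=(V,E)$ and $G_2=(V',E')$ with $V\cap V'=\emptyset$ is the graph on the vertex set $V\cup V'$ with edge set $E\cup E'\cup\{\{i,j\} : i\in V,\ j\in V'\}$. *)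

theory Defs
  imports "HOL-Analysis.Analysis"
begin

type_synonym 'a graph = "'a set \<times> 'a set set"

definition simple_graph :: "'a graph \<Rightarrow> bool" where
  "simple_graph G \<longleftrightarrow> finite (fst G) \<and> (\<forall>e\<in>snd G. e \<subseteq> fst G \<and> card e = 2)"

definition graph_join :: "'a graph \<Rightarrow> 'a graph \<Rightarrow> 'a graph" where
  "graph_join G H =
     (fst G \<union> fst H, snd G \<union> snd H \<union> {{i, j} | i j. i \<in> fst G \<and> j \<in> fst H})"

(* The pair (i, j) runs over both orders of every edge, so both signs occur.
   The vertex set may be a proper subset of the index type 'a: R^V is then embedded in
   real^'a as a coordinate subspace. Dimensions of faces are affine dimensions
   (aff_dim), so facets do not depend on the ambient space. *)
definition symmetric_edge_polytope :: "'a::finite graph \<Rightarrow> (real ^ 'a) set" where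
  "symmetric_edge_polytope G = convex hull {axis i 1 - axis j 1 | i j. {i, j} \<in> snd G}"

definition num_facets :: "'b::euclidean_space set \<Rightarrow> nat" where
  "num_facets P = card {F. F facet_of P}"

end

theory Submission
  imports Defs
begin

text \<open>
  A facet of the symmetric edge polytope of a connected graph \<open>G\<close> is cut out by an inequality
  \<open>h \<bullet> x \<le> 1\<close>, where \<open>h\<close> is a potential on the vertices that changes by at most
  \<open>1\<close> along each edge. The face has codimension one exactly when the tight edges, those along which
  \<open>h\<close> changes by \<open>1\<close>, connect all vertices. Hence facets correspond to such potentials up to
  additive constants (\<open>tight_potential_imp_facet\<close>, \<open>facet_imp_tight_potential\<close>,
  \<open>tight_face_inj\<close>), and the potentials are integer valued after a shift.

  In a join every vertex of one side is adjacent to every vertex of the other, so few potentials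
  exist (\<open>tight_potential_join_cases\<close>). Either \<open>h\<close> is constant on one side, say \<open>0\<close>
  on \<open>V'\<close>, and is then a signing of the other side: a map to \<open>{-1, 0, 1}\<close> in which no
  edge joins \<open>-1\<close> to \<open>1\<close> and each zero has a nonzero neighbour. Or \<open>h\<close> is a cut:
  it takes two consecutive values, both of them on each side, which leaves at most
  \<open>(2 ^ a - 2) * (2 ^ b - 2)\<close> possibilities for \<open>a = card V\<close> and \<open>b = card V'\<close>. The
  two potentials that are constant on both sides are signings for either side. With
  \<open>D\<close> and \<open>D'\<close> the numbers of signings, the number \<open>N\<close> of facets thus satisfies
  \<open>D + D' - 2 \<le> N \<le> D + D' - 2 + (2 ^ a - 2) * (2 ^ b - 2)\<close>.

  Any set of vertices is the positive set of some signing, so \<open>D \<ge> 2 ^ a\<close>; this gives the lower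
  bounds, because \<open>2 ^ a + 2 ^ b\<close> is smallest for balanced \<open>a\<close> and \<open>b\<close>.

  For the upper bounds, \<open>D\<close> is at most its value \<open>M a\<close> (\<open>max_signings\<close>) on a disjoint
  union of edges, together with one triangle if \<open>a \<ge> 3\<close> is odd, or on an isolated vertex if
  \<open>a = 1\<close>. The proof is by induction: restricting to a vertex set
  \<open>R\<close> bounds \<open>D\<close> by the number of patterns on \<open>R\<close> times the number of signings of the
  induced graph on the remaining vertices (\<open>card_signings_le_mult\<close>). As \<open>M\<close> is
  supermultiplicative, it suffices to find a nonempty \<open>R\<close> with at most \<open>M (card R)\<close>
  patterns, and the end of a longest path supplies one: either a clique of at most three
  vertices that contains a closed neighbourhood, or a cycle of length at least four (\<open>clique_or_cycle\<close>). Finally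
  \<open>M a + M b + (2 ^ a - 2) * (2 ^ b - 2) \<le> M (a + b - 1) + 2\<close>, with equality when one
  side is a single vertex, and \<open>M (a + b - 1)\<close> is the upper bound of the theorem for
  \<open>a + b \<ge> 3\<close>.
\<close>

section \<open>Facets and tight potentials\<close>

definition tight_face :: "'a set set \<Rightarrow> ('a::finite \<Rightarrow> real) \<Rightarrow> (real ^ 'a) set" where
  "tight_face E h = convex hull {axis i 1 - axis j 1 | i j. {i, j} \<in> E \<and> h i - h j = 1}"

text \<open>Connectedness of the tight edges is stated through cuts: no nonempty proper vertex set \<open>C\<close> is
closed under them. In this form it yields an induction principle along tight edges, and a failing
\<open>C\<close> is directly a direction orthogonal to the face. As edges are unordered, the one-sided bound
controls both signs of the difference.\<close>

definition tight_potential :: "'a set set \<Rightarrow> 'a set \<Rightarrow> ('a \<Rightarrow> real) \<Rightarrow> bool" where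
  "tight_potential E V h \<longleftrightarrow>
     (\<forall>i j. {i, j} \<in> E \<longrightarrow> h i - h j \<le> 1) \<and>
     (\<forall>C. C \<subseteq> V \<longrightarrow> C \<noteq> {} \<longrightarrow> C \<noteq> V \<longrightarrow> (\<exists>i\<in>C. \<exists>j\<in>V - C. {i, j} \<in> E \<and> \<bar>h i - h j\<bar> = 1))"

lemma tight_potential_bound:
  "tight_potential E V h \<Longrightarrow> {i, j} \<in> E \<Longrightarrow> h i - h j \<le> 1"
  by (simp add: tight_potential_def)

lemma tight_potential_cut:
  assumes "tight_potential E V h" "C \<subseteq> V" "C \<noteq> {}" "C \<noteq> V"
  obtains i j where "i \<in> C" "j \<in> V - C" "{i, j} \<in> E" "\<bar>h i - h j\<bar> = 1"
  using assms unfolding tight_potential_def by metis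

lemma tight_potential_induct:
  assumes "tight_potential E V h" "r \<in> V" "Q r" "v \<in> V"
    and step: "\<And>i j. i \<in> V \<Longrightarrow> j \<in> V \<Longrightarrow> {i, j} \<in> E \<Longrightarrow> \<bar>h i - h j\<bar> = 1 \<Longrightarrow> Q i \<Longrightarrow> Q j"
  shows "Q v"
proof (rule ccontr)
  let ?C = "{u \<in> V. Q u}"
  assume "\<not> Q v"
  then have "?C \<subseteq> V" "?C \<noteq> {}" "?C \<noteq> V" using assms by auto
  then obtain i j where "i \<in> ?C" "j \<in> V - ?C" "{i, j} \<in> E" "\<bar>h i - h j\<bar> = 1"
    using tight_potential_cut[OF assms(1), of ?C] by blast
  then show False using step[of i j] by auto
qed

lemma inner_potential_edge:
  "(\<chi> v. h v) \<bullet> (axis i 1 - axis j 1) = h i - (h j :: real)"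
  by (simp add: inner_diff_right inner_axis)

text \<open>A face of a convex hull is the hull of generators that it contains; the generators lying in the
supporting hyperplane are those of the tight edges.\<close>

lemma edge_polytope_face_eq_tight_face:
  assumes bound: "\<And>i j. {i, j} \<in> E \<Longrightarrow> h i - h j \<le> 1"
  shows "symmetric_edge_polytope (V, E) \<inter> {x. (\<chi> v. h v) \<bullet> x = 1} = tight_face E h"
    and "tight_face E h face_of symmetric_edge_polytope (V, E)"
proof -
  let ?S = "{axis i 1 - axis j 1 :: real^'a | i j. {i, j} \<in> E}"
  let ?T = "{axis i 1 - axis j 1 :: real^'a | i j. {i, j} \<in> E \<and> h i - h j = 1}"
  let ?P = "symmetric_edge_polytope (V, E)"
  let ?F = "?P \<inter> {x. (\<chi> v. h v) \<bullet> x = 1}"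
  have P: "?P = convex hull ?S" by (simp add: symmetric_edge_polytope_def)
  have "finite ?S"
    by (rule finite_subset[of _ "(\<lambda>(i, j). axis i 1 - axis j 1) ` UNIV"]) auto
  have "?S \<subseteq> {x. (\<chi> v. h v) \<bullet> x \<le> 1}"
    using bound by (auto simp: inner_potential_edge)
  then have "?P \<subseteq> {x. (\<chi> v. h v) \<bullet> x \<le> 1}"
    unfolding P by (rule hull_minimal) (rule convex_halfspace_le)
  then have face: "?F face_of ?P"
    by (intro face_of_Int_supporting_hyperplane_le) (auto simp: P)
  define F where "F = ?F"
  have "F face_of convex hull ?S" using face unfolding P[symmetric] F_def .
  then obtain S' where "S' \<subseteq> ?S" "F = convex hull S'"
    using finite_imp_compact[OF \<open>finite ?S\<close>] by (elim face_of_convex_hull_subset[rotated])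
  then have S': "S' \<subseteq> ?S" "?F = convex hull S'" unfolding F_def by blast+
  have "S' \<subseteq> ?F" using S'(2) hull_subset by metis
  have "S' \<subseteq> ?T"
  proof
    fix x assume "x \<in> S'"
    with S' obtain i j where x: "x = axis i 1 - axis j 1" "{i, j} \<in> E" by blast
    have "(\<chi> v. h v) \<bullet> x = 1" using \<open>S' \<subseteq> ?F\<close> \<open>x \<in> S'\<close> by auto
    then show "x \<in> ?T" using x by (auto simp: inner_potential_edge)
  qed
  then have "?F \<subseteq> tight_face E h"
    unfolding S'(2) tight_face_def by (rule hull_mono)
  moreover have "tight_face E h \<subseteq> ?F"
    unfolding tight_face_def
  proof (rule hull_minimal)
    have "?T \<subseteq> ?P" unfolding P using hull_subset[of ?S convex] by blast
    then show "?T \<subseteq> ?F" by (auto simp: inner_potential_edge)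
    show "convex ?F"
      unfolding P by (intro convex_Int convex_convex_hull convex_hyperplane)
  qed
  ultimately show eq: "?F = tight_face E h" by blast
  show "tight_face E h face_of ?P" using face unfolding eq .
qed

lemma edge_vector_in_polytope:
  "{i, j} \<in> E \<Longrightarrow> axis i 1 - axis j 1 \<in> symmetric_edge_polytope (V, E)"
  unfolding symmetric_edge_polytope_def by (rule hull_inc) auto

lemma zero_in_edge_polytope:
  assumes "{i, j} \<in> E"
  shows "0 \<in> symmetric_edge_polytope (V, E)"
proof -
  let ?P = "symmetric_edge_polytope (V, E)"
  have "axis i 1 - axis j 1 \<in> ?P" "axis j 1 - axis i 1 \<in> ?P"
    using assms by (auto intro: edge_vector_in_polytope simp: insert_commute)
  moreover have "convex ?P" by (simp add: symmetric_edge_polytope_def)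
  ultimately have "(1/2) *\<^sub>R (axis i 1 - axis j 1) + (1/2) *\<^sub>R (axis j 1 - axis i 1) \<in> ?P"
    by (intro convexD) auto
  then show ?thesis by (simp add: algebra_simps)
qed

text \<open>Tight paths express every \<open>axis v 1 - axis r 1\<close> as a combination of tight edge vectors, so the linear
span of the face contains the polytope. The affine hull of the face misses the origin, which lies in
the polytope, and so has exactly one dimension less.\<close>

lemma tight_potential_imp_facet:
  assumes h: "tight_potential E V h" and EV: "\<And>e. e \<in> E \<Longrightarrow> e \<subseteq> V"
    and r: "r \<in> V" and s: "s \<in> V" "s \<noteq> r"
  shows "tight_face E h facet_of symmetric_edge_polytope (V, E)"
proof -
  let ?P = "symmetric_edge_polytope (V, E)" and ?F = "tight_face E h"
  note bound = tight_potential_bound[OF h]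
  note Feq = edge_polytope_face_eq_tight_face[of E h, OF bound, where V=V]
  have "{r} \<noteq> V" using s by blast
  then obtain t where t: "{r, t} \<in> E" using tight_potential_cut[OF h, of "{r}"] r by auto
  have tight_in: "axis i 1 - axis j 1 \<in> span ?F" if "{i, j} \<in> E" "\<bar>h i - h j\<bar> = 1" for i j
  proof -
    have gen: "axis k 1 - axis l 1 \<in> span ?F" if "{k, l} \<in> E" "h k - h l = 1" for k l
      unfolding tight_face_def by (rule span_base, rule hull_inc) (use that in blast)
    show ?thesis
    proof (cases "h i - h j = 1")
      case True then show ?thesis using gen that by blast
    next
      case False
      then have "axis j 1 - axis i 1 \<in> span ?F" using gen[of j i] that by (auto simp: insert_commute)
      then show ?thesis using span_neg by fastforce
    qed
  qed
  \<comment> \<open>The vertices whose vector lies in the span are closed under tight edges.\<close>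
  have root: "axis v 1 - axis r 1 \<in> span ?F" if "v \<in> V" for v
  proof (rule tight_potential_induct[OF h r _ that])
    show "axis r 1 - axis r 1 \<in> span ?F" by (simp add: span_zero)
  next
    fix i j assume "{i, j} \<in> E" "\<bar>h i - h j\<bar> = 1" "axis i 1 - axis r 1 \<in> span ?F"
    then have "(axis i 1 - axis r 1) - (axis i 1 - axis j 1) \<in> span ?F"
      using span_diff tight_in by blast
    then show "axis j 1 - axis r 1 \<in> span ?F" by simp
  qed
  have "?P \<subseteq> span ?F"
    unfolding symmetric_edge_polytope_def
  proof (rule hull_minimal)
    show "convex (span ?F)" by (simp add: subspace_imp_convex)
    show "{axis i 1 - axis j 1 |i j. {i, j} \<in> snd (V, E)} \<subseteq> span ?F"
    proof clarsimp
      fix i j assume "{i, j} \<in> E"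
      then have "i \<in> V" "j \<in> V" using EV by auto
      from span_diff[OF root[OF this(1)] root[OF this(2)]]
      show "axis i 1 - axis j 1 \<in> span ?F" by simp
    qed
  qed
  also have "span ?F = affine hull (insert 0 ?F)"
    by (metis affine_hull_span_0 hull_inc insertI1 span_insert_0)
  finally have "aff_dim ?P \<le> aff_dim (insert 0 ?F)"
    by (metis aff_dim_affine_hull aff_dim_subset)
  then have le: "aff_dim ?P \<le> aff_dim ?F + 1"
    by (simp add: aff_dim_insert split: if_splits)
  have "?F \<subseteq> {x. (\<chi> v. h v) \<bullet> x = 1}" using Feq(1) by blast
  then have "0 \<notin> ?F" by auto
  moreover have "0 \<in> ?P" using t by (rule zero_in_edge_polytope)
  ultimately have "?F \<noteq> ?P" by blast
  moreover have "convex ?P" by (simp add: symmetric_edge_polytope_def)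
  ultimately have lt: "aff_dim ?F < aff_dim ?P" using Feq(2) face_of_aff_dim_lt by blast
  have "?F \<noteq> {}"
  proof
    assume "?F = {}"
    then have "?P \<subseteq> {0}" using \<open>?P \<subseteq> span ?F\<close> by simp
    then have "axis r 1 - axis t 1 = (0 :: real^'a)" using edge_vector_in_polytope[OF t, of V] by auto
    then have "r = t" by (simp add: axis_eq_axis)
    have "axis s 1 - axis r 1 = (0::real^'a)" using root[OF s(1)] \<open>?F = {}\<close> by simp
    then show False using s by (simp add: axis_eq_axis)
  qed
  then show ?thesis unfolding facet_of_def using Feq(2) le lt by simp
qed

text \<open>The tight edges of \<open>h\<close> give points of the common face, so \<open>g\<close> changes by the same amount
along them, and these edges connect everything.\<close>

lemma tight_face_inj:
  assumes h: "tight_potential E V h" and g: "tight_potential E V g"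
    and eq: "tight_face E h = tight_face E g" and "r \<in> V" "v \<in> V"
  shows "g v - h v = g r - h r"
proof (rule tight_potential_induct[OF h, of r "\<lambda>v. g v - h v = g r - h r", OF \<open>r \<in> V\<close> refl \<open>v \<in> V\<close>])
  have *: "g i - g j = 1" if "{i, j} \<in> E" "h i - h j = 1" for i j
  proof -
    have "axis i 1 - axis j 1 \<in> tight_face E h"
      unfolding tight_face_def by (rule hull_inc) (use that in blast)
    moreover have "tight_face E h \<subseteq> {x. (\<chi> v. g v) \<bullet> x = 1}"
      using edge_polytope_face_eq_tight_face(1)[of E g, OF tight_potential_bound[OF g], where V=V]
      unfolding eq by blast
    ultimately show ?thesis by (auto simp: inner_potential_edge)
  qed
  fix i j assume "{i, j} \<in> E" "\<bar>h i - h j\<bar> = 1" "g i - h i = g r - h r"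
  moreover from this have "{j, i} \<in> E" "h i - h j = 1 \<or> h j - h i = 1"
    by (auto simp: insert_commute)
  ultimately show "g j - h j = g r - h r" using *[of i j] *[of j i] by fastforce
qed

text \<open>By central symmetry the supporting hyperplane of a facet does not pass through the origin, so it can
be written \<open>h \<bullet> x = 1\<close>. If the tight edges left a cut \<open>C\<close> uncrossed, the indicator of
\<open>C\<close> would vanish on the facet and on the origin. The facet and the origin together have the same affine
hull as the polytope, but the indicator does not vanish on an edge vector crossing the cut.\<close>

lemma facet_imp_tight_potential:
  assumes F: "F facet_of symmetric_edge_polytope (V, E)"
    and EV: "\<And>e. e \<in> E \<Longrightarrow> e \<subseteq> V"
    and conn: "\<And>C. C \<subseteq> V \<Longrightarrow> C \<noteq> {} \<Longrightarrow> C \<noteq> V \<Longrightarrow> \<exists>i\<in>C. \<exists>j\<in>V - C. {i, j} \<in> E"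
    and st: "{s, t} \<in> E"
  obtains h where "tight_potential E V h" "F = tight_face E h"
proof -
  let ?P = "symmetric_edge_polytope (V, E)"
  let ?S = "{axis i 1 - axis j 1 :: real^'a | i j. {i, j} \<in> E}"
  have P: "?P = convex hull ?S" by (simp add: symmetric_edge_polytope_def)
  have "finite ?S"
    by (rule finite_subset[of _ "(\<lambda>(i, j). axis i 1 - axis j 1) ` UNIV"]) auto
  then have "polyhedron ?P" unfolding P by (simp add: polyhedron_convex_hull)
  then obtain a b where ab: "?P \<subseteq> {x. a \<bullet> x \<le> b}" "F = ?P \<inter> {x. a \<bullet> x = b}"
    using facet_of_polyhedron[OF _ F] by metis
  have "0 \<in> ?P" using st by (rule zero_in_edge_polytope)
  have edge_le: "a $ i - a $ j \<le> b" if "{i, j} \<in> E" for i j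
    using edge_vector_in_polytope[OF that, of V] ab(1) inner_potential_edge[of "\<lambda>i. a $ i" i j]
    by auto
  have "b \<ge> 0" using \<open>0 \<in> ?P\<close> ab(1) by auto
  \<comment> \<open>For \<open>b = 0\<close> the polytope and its negative both lie in the half-space, so the facet would be
    the whole polytope.\<close>
  have "b \<noteq> 0"
  proof
    assume "b = 0"
    have "?S \<subseteq> {x. a \<bullet> x = b}"
    proof clarsimp
      fix i j assume "{i, j} \<in> E"
      then have "{j, i} \<in> E" by (simp add: insert_commute)
      with edge_le[of i j] edge_le[of j i] \<open>{i, j} \<in> E\<close> \<open>b = 0\<close>
      show "a \<bullet> (axis i 1 - axis j 1) = b" using inner_potential_edge[of "\<lambda>i. a $ i" i j] by simp
    qed
    then have "?P \<subseteq> {x. a \<bullet> x = b}"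
      unfolding P by (rule hull_minimal) (rule convex_hyperplane)
    then have "F = ?P" using ab(2) by blast
    then show False using F by (simp add: facet_of_def)
  qed
  with \<open>b \<ge> 0\<close> have "b > 0" by simp
  define h where "h i = a $ i / b" for i
  have ha: "(\<chi> v. h v) \<bullet> x = a \<bullet> x / b" for x :: "real^'a"
    by (simp add: h_def inner_vec_def sum_divide_distrib)
  have bound: "h i - h j \<le> 1" if "{i, j} \<in> E" for i j
    using edge_le[OF that] \<open>b > 0\<close> by (simp add: h_def divide_simps)
  have "F = ?P \<inter> {x. (\<chi> v. h v) \<bullet> x = 1}" using ab(2) \<open>b > 0\<close> by (auto simp: ha)
  also have "\<dots> = tight_face E h" using bound by (rule edge_polytope_face_eq_tight_face)
  finally have Fh: "F = tight_face E h" .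
  have "\<exists>i\<in>C. \<exists>j\<in>V - C. {i, j} \<in> E \<and> \<bar>h i - h j\<bar> = 1"
    if C: "C \<subseteq> V" "C \<noteq> {}" "C \<noteq> V" for C
  proof (rule ccontr)
    assume no: "\<not> ?thesis"
    let ?d = "(\<chi> v. indicator C v) :: real^'a"
    have same: "i \<in> C \<longleftrightarrow> j \<in> C" if "{i, j} \<in> E" "h i - h j = 1" for i j
    proof -
      have "i \<in> V" "j \<in> V" using EV[OF that(1)] by auto
      moreover have "\<bar>h i - h j\<bar> = 1" "\<bar>h j - h i\<bar> = 1" "{j, i} \<in> E" using that by (auto simp: insert_commute)
      ultimately show ?thesis using no that(1) by blast
    qed
    have "F \<subseteq> {x. ?d \<bullet> x = 0}"
      unfolding Fh tight_face_def
    proof (rule hull_minimal)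
      show "{axis i 1 - axis j 1 |i j. {i, j} \<in> E \<and> h i - h j = 1} \<subseteq> {x. ?d \<bullet> x = 0}"
        using same by (auto simp: inner_potential_edge indicator_def)
    qed (rule convex_hyperplane)
    then have sub: "insert 0 F \<subseteq> {x. ?d \<bullet> x = 0}" by auto
    have "affine hull F \<subseteq> {x. a \<bullet> x = b}"
      by (rule hull_minimal) (auto simp: ab(2) affine_hyperplane)
    then have "0 \<notin> affine hull F" using \<open>b > 0\<close> by auto
    then have "aff_dim (insert 0 F) = aff_dim F + 1" by (simp add: aff_dim_insert)
    also have "\<dots> = aff_dim ?P" using F by (simp add: facet_of_def)
    finally have "affine hull (insert 0 F) = affine hull ?P"
      using \<open>0 \<in> ?P\<close> ab(2) aff_dim_eq_full_gen[of "insert 0 F" ?P] by auto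
    moreover have "affine hull (insert 0 F) \<subseteq> {x. ?d \<bullet> x = 0}"
      using sub by (rule hull_minimal) (rule affine_hyperplane)
    ultimately have "?P \<subseteq> {x. ?d \<bullet> x = 0}" using hull_subset[of ?P affine] by simp
    moreover obtain i j where "i \<in> C" "j \<in> V - C" "{i, j} \<in> E" using conn[OF C] by blast
    ultimately show False
      using edge_vector_in_polytope[of i j E V] by (auto simp: inner_potential_edge)
  qed
  then have "tight_potential E V h" using bound by (simp add: tight_potential_def)
  then show ?thesis using Fh that by blast
qed

section \<open>Signings of a graph\<close>

definition signings :: "'a set set \<Rightarrow> 'a set \<Rightarrow> ('a \<Rightarrow> int) set" where
  "signings E V = {f. (\<forall>v. f v \<in> {-1, 0, 1}) \<and> (\<forall>v. v \<notin> V \<longrightarrow> f v = 0) \<and>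
     (\<forall>u\<in>V. \<forall>v\<in>V. {u, v} \<in> E \<longrightarrow> f u * f v \<noteq> -1) \<and>
     (\<forall>v\<in>V. f v = 0 \<longrightarrow> (\<exists>u\<in>V. {u, v} \<in> E \<and> f u \<noteq> 0))}"

text \<open>The traces that a signing of \<open>V\<close> can leave on \<open>R\<close>: a zero must be dominated inside \<open>R\<close>
only if all its neighbours lie in \<open>R\<close>.\<close>

definition boundary_patterns :: "'a set set \<Rightarrow> 'a set \<Rightarrow> 'a set \<Rightarrow> ('a \<Rightarrow> int) set" where
  "boundary_patterns E V R = {f. (\<forall>v. f v \<in> {-1, 0, 1}) \<and> (\<forall>v. v \<notin> R \<longrightarrow> f v = 0) \<and>
     (\<forall>u\<in>R. \<forall>v\<in>R. {u, v} \<in> E \<longrightarrow> f u * f v \<noteq> -1) \<and>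
     (\<forall>v\<in>R. f v = 0 \<longrightarrow> (\<forall>u\<in>V. {u, v} \<in> E \<longrightarrow> u \<in> R) \<longrightarrow> (\<exists>u\<in>R. {u, v} \<in> E \<and> f u \<noteq> 0))}"

lemma finite_three_valued:
  assumes "finite V"
  shows "finite {f :: 'a \<Rightarrow> int. (\<forall>v. f v \<in> {-1, 0, 1}) \<and> (\<forall>v. v \<notin> V \<longrightarrow> f v = 0)}"
  using finite_set_of_finite_funs[OF assms, of "{-1, 0, 1 :: int}" 0]
  by (rule rev_finite_subset) auto

lemma finite_signings: "finite V \<Longrightarrow> finite (signings E V)"
  by (rule finite_subset[OF _ finite_three_valued]) (auto simp: signings_def)

lemma finite_boundary_patterns: "finite R \<Longrightarrow> finite (boundary_patterns E V R)"
  by (rule finite_subset[OF _ finite_three_valued]) (auto simp: boundary_patterns_def)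

text \<open>Any \<open>X \<subseteq> V\<close> is the positive set of a signing: the vertices outside \<open>X\<close> get \<open>0\<close> if
they have a neighbour in \<open>X\<close>, and \<open>-1\<close> otherwise.\<close>

lemma card_signings_ge:
  assumes "finite V"
  shows "2 ^ card V \<le> card (signings E V)"
proof -
  define f where "f X v = (if v \<in> X then 1 else
      if v \<in> V \<and> (\<forall>u\<in>X. {u, v} \<notin> E) then -1 else 0 :: int)" for X v
  have f_pos: "f X v = 1 \<longleftrightarrow> v \<in> X" for X v by (simp add: f_def)
  have "inj_on f (Pow V)"
    by (rule inj_onI) (metis f_pos subsetI subset_antisym)
  moreover have "f ` Pow V \<subseteq> signings E V"
  proof clarify
    fix X assume "X \<subseteq> V"
    then show "f X \<in> signings E V"
      unfolding signings_def f_def by (auto simp: insert_commute split: if_splits)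
  qed
  ultimately have "card (Pow V) \<le> card (signings E V)"
    using card_inj_on_le finite_signings[OF \<open>finite V\<close>] by blast
  then show ?thesis by (simp add: card_Pow \<open>finite V\<close>)
qed

text \<open>Restricting a signing to \<open>W = V - R\<close> may leave bare zeros, which were dominated only from \<open>R\<close>.
They are repaired in two rounds: a bare zero with a positive neighbour in \<open>R\<close> becomes \<open>-1\<close>,
and a remaining bare zero becomes \<open>1\<close> unless the first round has dominated it. The repair is a
signing of \<open>W\<close>, and it can be undone from the pattern on \<open>R\<close>: a vertex with a positive
neighbour in \<open>R\<close> cannot carry \<open>-1\<close> in the original signing, so a \<open>-1\<close> there is
a mark; dually for \<open>1\<close> at a vertex that has only negative neighbours among the nonzero
vertices of \<open>R\<close>.\<close>

lemma card_signings_le_mult: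
  assumes "finite V" and "R \<subseteq> V"
  shows "card (signings E V) \<le> card (boundary_patterns E V R) * card (signings E (V - R))"
proof -
  let ?W = "V - R"
  define near where "near s f v \<longleftrightarrow> (\<exists>u\<in>R. {u, v} \<in> E \<and> f u = s)" for s :: int and f :: "'a \<Rightarrow> int" and v
  define bare where "bare f v \<longleftrightarrow> v \<in> ?W \<and> f v = 0 \<and> (\<forall>u\<in>?W. {u, v} \<in> E \<longrightarrow> f u = 0)" for f :: "'a \<Rightarrow> int" and v
  define mark where "mark f v = (if v \<notin> ?W then 0 else
     if bare f v \<and> near 1 f v then -1 else
     if bare f v \<and> \<not> (\<exists>u\<in>?W. {u, v} \<in> E \<and> bare f u \<and> near 1 f u) then 1 else f v)"
    for f :: "'a \<Rightarrow> int" and v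
  define restr where "restr f v = (if v \<in> R then f v else 0)" for f :: "'a \<Rightarrow> int" and v
  have sgnD: "f v \<in> {-1, 0, 1}" "v \<notin> V \<Longrightarrow> f v = 0"
     "u \<in> V \<Longrightarrow> v \<in> V \<Longrightarrow> {u, v} \<in> E \<Longrightarrow> f u * f v \<noteq> -1"
     "v \<in> V \<Longrightarrow> f v = 0 \<Longrightarrow> \<exists>u\<in>V. {u, v} \<in> E \<and> f u \<noteq> 0"
    if "f \<in> signings E V" for f u v
    using that unfolding signings_def by blast+
  have bare_near: "near 1 f v \<or> near (-1) f v" if f: "f \<in> signings E V" and "bare f v" for f v
  proof -
    have "v \<in> V" "f v = 0" using that by (auto simp: bare_def)
    then obtain u where u: "u \<in> V" "{u, v} \<in> E" "f u \<noteq> 0" using sgnD(4)[OF f] by blast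
    then have "u \<in> R" using \<open>bare f v\<close> by (auto simp: bare_def)
    then show ?thesis using u sgnD(1)[OF f, of u] by (auto simp: near_def)
  qed
  have nb: "f u = 0" if "bare f v" "{u, v} \<in> E" "u \<in> ?W" for f u v
    using that by (auto simp: bare_def)
  have mark_in: "mark f \<in> signings E ?W" if f: "f \<in> signings E V" for f
  proof -
    have vals: "mark f v \<in> {-1, 0, 1}" for v using sgnD(1)[OF f, of v] by (simp add: mark_def)
    have out: "v \<notin> ?W \<Longrightarrow> mark f v = 0" for v by (simp add: mark_def)
    have keep: "f v \<noteq> 0 \<Longrightarrow> v \<in> ?W \<Longrightarrow> mark f v = f v" for v by (auto simp: mark_def bare_def)
    have unmarked: "\<not> bare f v \<Longrightarrow> v \<in> ?W \<Longrightarrow> mark f v = f v" for v by (auto simp: mark_def)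
    have compat: "mark f u * mark f v \<noteq> -1" if uv: "u \<in> ?W" "v \<in> ?W" "{u, v} \<in> E" for u v
    proof (cases "bare f u \<and> bare f v")
      case True
      then have fz: "f u = 0" "f v = 0" by (auto simp: bare_def)
      have vu: "{v, u} \<in> E" using uv by (simp add: insert_commute)
      show ?thesis
        using True fz uv vu unfolding mark_def by auto
    next
      case False
      have vu: "{v, u} \<in> E" using uv by (simp add: insert_commute)
      show ?thesis
      proof (cases "bare f u \<or> bare f v")
        case True
        then have "mark f u = 0 \<or> mark f v = 0"
          using False nb[of f v u] nb[of f u v] unmarked[of u] unmarked[of v] uv vu by metis
        then show ?thesis by auto
      next
        case False
        then show ?thesis using unmarked[of u] unmarked[of v] uv sgnD(3)[OF f, of u v] by auto
      qed
    qed
    have dom: "\<exists>u\<in>?W. {u, v} \<in> E \<and> mark f u \<noteq> 0" if v: "v \<in> ?W" "mark f v = 0" for v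
    proof (cases "bare f v")
      case True
      with v obtain u where "u \<in> ?W" "{u, v} \<in> E" "bare f u" "near 1 f u"
        by (auto simp: mark_def split: if_splits)
      then show ?thesis by (intro bexI[of _ u]) (auto simp: mark_def)
    next
      case False
      then have "f v = 0" using v unmarked by simp
      with False v obtain u where "u \<in> ?W" "{u, v} \<in> E" "f u \<noteq> 0" by (auto simp: bare_def)
      then show ?thesis using keep by metis
    qed
    show ?thesis unfolding signings_def using vals out compat dom by blast
  qed
  have restr_in: "restr f \<in> boundary_patterns E V R" if f: "f \<in> signings E V" for f
  proof -
    have "\<exists>u\<in>R. {u, v} \<in> E \<and> restr f u \<noteq> 0"
      if v: "v \<in> R" "restr f v = 0" "\<forall>u\<in>V. {u, v} \<in> E \<longrightarrow> u \<in> R" for v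
    proof -
      have "v \<in> V" "f v = 0" using v assms(2) by (auto simp: restr_def)
      then obtain u where u: "u \<in> V" "{u, v} \<in> E" "f u \<noteq> 0" using sgnD(4)[OF f] by blast
      then have "u \<in> R" using v by blast
      then show ?thesis using u by (auto simp: restr_def)
    qed
    then show ?thesis
      unfolding boundary_patterns_def using sgnD(1)[OF f] sgnD(3)[OF f] assms(2)
      by (simp add: restr_def subset_iff)
  qed
  \<comment> \<open>Undoing the marks, using the pattern on \<open>R\<close> alone.\<close>
  have recover: "f v = (if v \<in> R then restr f v
      else if near 1 (restr f) v \<and> mark f v = -1 then 0
      else if \<not> near 1 (restr f) v \<and> near (-1) (restr f) v \<and> mark f v = 1 then 0
      else mark f v)" if f: "f \<in> signings E V" for f v
  proof -
    have nr: "near s (restr f) v = near s f v" for s by (auto simp: near_def restr_def)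
    consider "v \<in> R" | "v \<notin> V" | "v \<in> ?W" by blast
    then show ?thesis
    proof cases
      case 1 then show ?thesis by (simp add: restr_def)
    next
      case 2 then show ?thesis using sgnD(2)[OF f] assms(2) by (auto simp: mark_def)
    next
      case 3
      have pos: "f v \<noteq> -1" if n: "near 1 f v"
      proof -
        obtain u where "u \<in> R" "{u, v} \<in> E" "f u = 1" using n by (auto simp: near_def)
        then show ?thesis using sgnD(3)[OF f, of u v] 3 assms(2) by auto
      qed
      have neg: "f v \<noteq> 1" if n: "near (-1) f v"
      proof -
        obtain u where "u \<in> R" "{u, v} \<in> E" "f u = -1" using n by (auto simp: near_def)
        then show ?thesis using sgnD(3)[OF f, of u v] 3 assms(2) by auto
      qed
      show ?thesis
      proof (cases "bare f v")
        case True
        then have "f v = 0" by (simp add: bare_def)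
        then show ?thesis using bare_near[OF f True] 3 True
          unfolding nr by (auto simp: mark_def)
      next
        case False
        then have "mark f v = f v" using 3 by (auto simp: mark_def)
        then show ?thesis unfolding nr using pos neg 3 by auto
      qed
    qed
  qed
  have "inj_on (\<lambda>f. (restr f, mark f)) (signings E V)"
  proof (rule inj_onI)
    fix f g assume f: "f \<in> signings E V" and g: "g \<in> signings E V"
      and "(restr f, mark f) = (restr g, mark g)"
    then have "restr f = restr g" "mark f = mark g" by auto
    then show "f = g" using recover[OF f] recover[OF g] by (auto intro!: ext)
  qed
  moreover have "(\<lambda>f. (restr f, mark f)) ` signings E V
      \<subseteq> boundary_patterns E V R \<times> signings E ?W"
    using restr_in mark_in by auto
  moreover have "finite (boundary_patterns E V R \<times> signings E ?W)"
    using assms finite_subset by (intro finite_cartesian_product finite_boundary_patterns finite_signings) auto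
  ultimately have "card (signings E V) \<le> card (boundary_patterns E V R \<times> signings E ?W)"
    by (rule card_inj_on_le)
  then show ?thesis by (simp add: card_cartesian_product)
qed

text \<open>On a clique the nonzero values all agree, and the vertex \<open>x\<close> whose neighbours all lie in \<open>R\<close>
excludes the zero pattern; so a pattern is a sign and a nonempty subset.\<close>

lemma card_boundary_patterns_clique:
  assumes "finite R" and clique: "\<And>u v. u \<in> R \<Longrightarrow> v \<in> R \<Longrightarrow> u \<noteq> v \<Longrightarrow> {u, v} \<in> E"
    and x: "x \<in> R" "\<And>u. u \<in> V \<Longrightarrow> {u, x} \<in> E \<Longrightarrow> u \<in> R"
  shows "card (boundary_patterns E V R) \<le> 2 * (2 ^ card R - 1)"
proof -
  let ?ind = "\<lambda>(s, X) v. if v \<in> X then s else 0 :: int"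
  let ?A = "{-1, 1 :: int} \<times> (Pow R - {{}})"
  have "boundary_patterns E V R \<subseteq> ?ind ` ?A"
  proof
    fix f assume "f \<in> boundary_patterns E V R"
    then have vals: "\<And>v. f v \<in> {-1, 0, 1}" and out: "\<And>v. v \<notin> R \<Longrightarrow> f v = 0"
      and compat: "\<And>u v. u \<in> R \<Longrightarrow> v \<in> R \<Longrightarrow> {u, v} \<in> E \<Longrightarrow> f u * f v \<noteq> -1"
      and dom: "f x = 0 \<Longrightarrow> \<exists>u\<in>R. {u, x} \<in> E \<and> f u \<noteq> 0"
      unfolding boundary_patterns_def using x by blast+
    obtain y where y: "y \<in> R" "f y \<noteq> 0" using dom x(1) by blast
    let ?X = "{v. f v \<noteq> 0}"
    have "f v = f y" if "f v \<noteq> 0" for v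
    proof (cases "v = y")
      case False
      have "v \<in> R" using out that by blast
      then have "f v * f y \<noteq> -1" using clique[of v y] compat[of v y] y False by blast
      then show ?thesis using vals[of v] vals[of y] that y by auto
    qed simp
    then have "f = ?ind (f y, ?X)" by (auto intro!: ext)
    moreover have "(f y, ?X) \<in> ?A" using vals[of y] y out by auto
    ultimately show "f \<in> ?ind ` ?A" by (rule image_eqI)
  qed
  then have "card (boundary_patterns E V R) \<le> card ?A"
    using \<open>finite R\<close> by (intro surj_card_le) auto
  also have "\<dots> = 2 * (2 ^ card R - 1)"
    using \<open>finite R\<close> by (simp add: card_cartesian_product card_Pow)
  finally show ?thesis .
qed

section \<open>Patterns on cycles\<close>

text \<open>The number of ways to interpolate \<open>n\<close> values between \<open>a\<close> and \<open>b\<close> without ever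
placing \<open>-1\<close> and \<open>1\<close> next to each other; patterns on a cycle are the closed such walks.\<close>

fun sign_walks :: "nat \<Rightarrow> int \<Rightarrow> int \<Rightarrow> nat" where
  "sign_walks 0 a b = (if a * b \<noteq> -1 then 1 else 0)"
| "sign_walks (Suc n) a b = (\<Sum>c\<in>{-1, 0, 1}. if a * c \<noteq> -1 then sign_walks n c b else 0)"

abbreviation sign_lists :: "nat \<Rightarrow> int \<Rightarrow> int \<Rightarrow> int list set" where
  "sign_lists n a b \<equiv> {xs. length xs = n \<and> set xs \<subseteq> {-1, 0, 1} \<and>
     successively (\<lambda>x y. x * y \<noteq> -1) (a # xs @ [b])}"

lemma finite_sign_lists: "finite (sign_lists n a b)"
  by (rule finite_subset[OF _ finite_lists_length_eq[of "{-1, 0, 1}" n]]) auto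

lemma card_sign_lists: "card (sign_lists n a b) \<le> sign_walks n a b"
proof (induction n arbitrary: a)
  case 0
  have "sign_lists 0 a b = (if a * b \<noteq> -1 then {[]} else {})" by auto
  then show ?case by simp
next
  case (Suc n)
  let ?C = "\<lambda>c. if a * c \<noteq> -1 then (#) c ` sign_lists n c b else {}"
  have "sign_lists (Suc n) a b \<subseteq> (\<Union>c\<in>{-1, 0, 1}. ?C c)"
  proof
    fix xs assume xs: "xs \<in> sign_lists (Suc n) a b"
    then obtain c ys where "xs = c # ys" by (cases xs) auto
    with xs show "xs \<in> (\<Union>c\<in>{-1, 0, 1}. ?C c)" by (intro UN_I[of c]) auto
  qed
  moreover have "finite (\<Union>c\<in>{-1, 0, 1}. ?C c)" using finite_sign_lists by auto
  ultimately have "card (sign_lists (Suc n) a b) \<le> card (\<Union>c\<in>{-1, 0, 1}. ?C c)"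
    by (rule card_mono[rotated])
  also have "\<dots> \<le> (\<Sum>c\<in>{-1, 0, 1}. card (?C c))" by (rule card_UN_le) simp
  also have "\<dots> \<le> sign_walks (Suc n) a b"
    unfolding sign_walks.simps
  proof (rule sum_mono)
    fix c show "card (?C c) \<le> (if a * c \<noteq> -1 then sign_walks n c b else 0)"
      using Suc.IH[of c] card_image_le[OF finite_sign_lists[of n c b], of "(#) c"] by auto
  qed
  finally show ?case .
qed

text \<open>Only the constraint along the edges of the cycle is kept; chords and domination can only reduce the
number of patterns.\<close>

lemma card_boundary_patterns_cycle:
  assumes c: "distinct (x # c)" "successively (\<lambda>u v. {u, v} \<in> E) (x # c @ [x])"
  shows "card (boundary_patterns E V (set (x # c))) \<le> (\<Sum>a\<in>{-1, 0, 1}. sign_walks (length c) a a)"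
proof -
  let ?B = "boundary_patterns E V (set (x # c))"
  let ?L = "\<Union>a\<in>{-1, 0, 1}. (#) a ` sign_lists (length c) a a"
  have "inj_on (\<lambda>f. map f (x # c)) ?B"
  proof (rule inj_onI)
    fix f g assume fg: "f \<in> ?B" "g \<in> ?B" "map f (x # c) = map g (x # c)"
    then have "f v = g v" if "v \<in> set (x # c)" for v using that by (metis map_eq_conv)
    moreover have "f v = g v" if "v \<notin> set (x # c)" for v
      using that fg unfolding boundary_patterns_def by auto
    ultimately show "f = g" by blast
  qed
  moreover have "(\<lambda>f. map f (x # c)) ` ?B \<subseteq> ?L"
  proof clarify
    fix f assume f: "f \<in> ?B"
    have "successively (\<lambda>u v. f u * f v \<noteq> -1) (x # c @ [x])"
      using c(2) by (rule successively_mono) (use f in \<open>auto simp: boundary_patterns_def\<close>)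
    then have "successively (\<lambda>a b. a * b \<noteq> -1) (map f (x # c @ [x]))"
      by (simp only: successively_map)
    moreover have "f v \<in> {-1, 0, 1}" for v using f unfolding boundary_patterns_def by blast
    ultimately show "map f (x # c) \<in> ?L"
      by (intro UN_I[of "f x"]) (auto simp: image_iff)
  qed
  moreover have "finite ?L" using finite_sign_lists by blast
  ultimately have "card ?B \<le> card ?L" by (rule card_inj_on_le)
  also have "\<dots> \<le> (\<Sum>a\<in>{-1, 0, 1}. card ((#) a ` sign_lists (length c) a a))"
    by (rule card_UN_le) simp
  also have "\<dots> \<le> (\<Sum>a\<in>{-1, 0, 1}. sign_walks (length c) a a)"
    using card_sign_lists by (intro sum_mono) (simp add: card_image)
  finally show ?thesis .
qed

section \<open>The extremal number of signings\<close>

text \<open>The number of signings of a disjoint union of edges (\<open>6\<close> each), with one isolated vertex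
(\<open>2\<close>) if there is a single vertex, and with one triangle (\<open>14\<close>) for odd numbers from
\<open>3\<close> on.\<close>

fun max_signings :: "nat \<Rightarrow> nat" where
  "max_signings 0 = 1"
| "max_signings (Suc 0) = 2"
| "max_signings (Suc (Suc 0)) = 6"
| "max_signings (Suc (Suc (Suc 0))) = 14"
| "max_signings (Suc (Suc (Suc (Suc n)))) = 6 * max_signings (Suc (Suc n))"

lemma max_signings_add_1: "2 * max_signings n \<le> max_signings (Suc n)"
  by (induction n rule: max_signings.induct) auto

lemma max_signings_add_2: "6 * max_signings n \<le> max_signings (Suc (Suc n))"
  by (induction n rule: max_signings.induct) auto

lemma max_signings_add_3: "14 * max_signings n \<le> max_signings (Suc (Suc (Suc n)))"
  by (induction n rule: max_signings.induct) auto

lemma max_signings_supermult: "max_signings m * max_signings n \<le> max_signings (m + n)"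
proof (induction m rule: max_signings.induct)
  case (5 m)
  then have "max_signings (Suc (Suc (Suc (Suc m)))) * max_signings n \<le> 6 * max_signings (Suc (Suc m) + n)"
    by simp
  also have "\<dots> \<le> max_signings (Suc (Suc (Suc (Suc m))) + n)"
    using max_signings_add_2[of "Suc (Suc m) + n"] by simp
  finally show ?case .
qed (use max_signings_add_1 max_signings_add_2 max_signings_add_3 in auto)

text \<open>The matrix of walk counts is symmetric and invariant under negating both ends, so three numbers remain:
\<open>p\<close> from \<open>1\<close> to \<open>1\<close>, \<open>q\<close> from \<open>0\<close> to \<open>1\<close>, and \<open>p - 1\<close> from
\<open>-1\<close> to \<open>1\<close>. There are \<open>4 * p - 1\<close> closed walks, and two more steps
replace \<open>p\<close> by \<open>3 * p + 2 * q - 1\<close>; the last inequality is exactly what bounds the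
growth of the closed walks over two steps by the factor \<open>6\<close>, and the one before it carries the
induction.\<close>

lemma sign_walks_values:
  "sign_walks n (-1) (-1) = sign_walks n 1 1 \<and> sign_walks n 0 (-1) = sign_walks n 0 1 \<and>
   sign_walks n (-1) 0 = sign_walks n 0 1 \<and> sign_walks n 1 0 = sign_walks n 0 1 \<and>
   sign_walks n 1 (-1) = sign_walks n (-1) 1 \<and>
   sign_walks n 1 1 = sign_walks n (-1) 1 + 1 \<and> sign_walks n 0 0 = sign_walks n 1 1 + sign_walks n (-1) 1 \<and>
   sign_walks n 1 1 \<le> sign_walks n 0 1 \<and> 8 * sign_walks n 0 1 + 1 \<le> 12 * sign_walks n 1 1"
  by (induction n) auto

lemma closed_walks_step:
  "(\<Sum>a\<in>{-1, 0, 1}. sign_walks (Suc (Suc n)) a a) \<le> 6 * (\<Sum>a\<in>{-1, 0, 1}. sign_walks n a a)"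
  using sign_walks_values[of n] by (auto simp del: sign_walks.simps(1))

text \<open>Cycles of length at least four have no more patterns than the extremal graph of the same size: the base
cases are \<open>35 \<le> 36\<close> and \<open>83 \<le> 84\<close>. For a triangle this fails, with \<open>15\<close>
walks against \<open>14\<close>, so triangles have to be treated as cliques.\<close>

lemma closed_walks_le:
  "(\<Sum>a\<in>{-1, 0, 1}. sign_walks (n + 3) a a) \<le> max_signings (n + 4)"
proof (induction n rule: nat_induct2)
  case 0 show ?case by (simp add: eval_nat_numeral)
next
  case 1 show ?case by (simp add: eval_nat_numeral)
next
  case (step n)
  have "(\<Sum>a\<in>{-1, 0, 1}. sign_walks (Suc (Suc (n + 3))) a a) \<le> 6 * max_signings (n + 4)"
    using closed_walks_step[of "n + 3"] step by linarith
  also have "\<dots> = max_signings (n + 2 + 4)" by (simp add: eval_nat_numeral)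
  finally show ?case by (simp add: eval_nat_numeral)
qed


lemma signings_empty: "signings E {} = {\<lambda>_. 0}"
  by (auto simp: signings_def)

text \<open>All neighbours of the first vertex \<open>x\<close> of a longest path lie on the path. The initial segment up to
the last of them closes up to a cycle, or has at most three vertices; in that case it is a
clique that contains all neighbours of \<open>x\<close>.\<close>

lemma clique_or_cycle:
  assumes "finite V" and "V \<noteq> {}" and loop: "\<And>v. {v} \<notin> E"
  obtains (clique) R x where "R \<subseteq> V" "card R \<in> {1, 2, 3}"
      "\<And>u v. u \<in> R \<Longrightarrow> v \<in> R \<Longrightarrow> u \<noteq> v \<Longrightarrow> {u, v} \<in> E"
      "x \<in> R" "\<And>u. u \<in> V \<Longrightarrow> {u, x} \<in> E \<Longrightarrow> u \<in> R"
    | (cycle) x c where "distinct (x # c)" "set (x # c) \<subseteq> V" "length c \<ge> 3"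
      "successively (\<lambda>u v. {u, v} \<in> E) (x # c @ [x])"
proof -
  let ?path = "\<lambda>p. distinct p \<and> set p \<subseteq> V \<and> p \<noteq> [] \<and> successively (\<lambda>u v. {u, v} \<in> E) p"
  have len: "length p < Suc (card V)" if "?path p" for p
    using that card_mono[OF \<open>finite V\<close>, of "set p"] by (simp add: distinct_card)
  obtain v where "v \<in> V" using \<open>V \<noteq> {}\<close> by blast
  then have "?path [v]" by simp
  then obtain p where p: "?path p" and longest: "\<And>q. ?path q \<Longrightarrow> length q \<le> length p"
    using ex_has_greatest_nat[of ?path "[v]" length "Suc (card V)"] len by blast
  obtain x c where pxc: "p = x # c" using p by (cases p) auto
  have nbr: "u \<in> set c" if "u \<in> V" "{u, x} \<in> E" for u
  proof (rule ccontr)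
    assume "u \<notin> set c"
    moreover have "u \<noteq> x" using that loop[of x] by auto
    ultimately have "?path (u # p)" using p that pxc by auto
    then show False using longest[of "u # p"] by simp
  qed
  let ?J = "{j. j < length c \<and> {c ! j, x} \<in> E}"
  have fin: "finite ?J" by simp
  show thesis
  proof (cases "?J = {}")
    case True
    then have "\<And>u. u \<in> V \<Longrightarrow> {u, x} \<in> E \<Longrightarrow> u \<in> {x}"
      using nbr by (metis (mono_tags, lifting) empty_iff in_set_conv_nth mem_Collect_eq)
    then show thesis using clique[of "{x}" x] p pxc by auto
  next
    case False
    \<comment> \<open>The last neighbour of \<open>x\<close> on the path is \<open>c ! j\<close>, so the segment \<open>x # d\<close> has
      \<open>j + 2\<close> vertices.\<close>
    define j where "j = Max ?J"
    have j: "j < length c" "{c ! j, x} \<in> E" using Max_in[OF fin False] by (auto simp: j_def)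
    have jmax: "i \<le> j" if "i < length c" "{c ! i, x} \<in> E" for i
      using Max_ge[OF fin, of i] that by (auto simp: j_def)
    define d where "d = take (Suc j) c"
    have d: "distinct (x # d)" "set (x # d) \<subseteq> V" "length d = Suc j"
      using p pxc j set_take_subset[of "Suc j" c] by (auto simp: d_def distinct_take dest: in_set_takeD)
    have dlast: "last d = c ! j" "d \<noteq> []" using j by (auto simp: d_def take_Suc_conv_app_nth)
    have "successively (\<lambda>u v. {u, v} \<in> E) ((x # d) @ drop (Suc j) c)"
      using p pxc by (simp add: d_def)
    then have "successively (\<lambda>u v. {u, v} \<in> E) (x # d)"
      unfolding successively_append_iff by simp
    then have dcyc: "successively (\<lambda>u v. {u, v} \<in> E) (x # d @ [x])"
      using j dlast by (simp add: successively_append_iff flip: append_Cons)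
    have nbr_d: "u \<in> set d" if u: "u \<in> V" "{u, x} \<in> E" for u
    proof -
      obtain i where i: "i < length c" "c ! i = u" using nbr[OF u] by (auto simp: in_set_conv_nth)
      then have "i \<le> j" using jmax u by simp
      then show ?thesis using i by (auto simp: d_def in_set_conv_nth intro!: exI[of _ i])
    qed
    show thesis
    proof (cases "j \<ge> 2")
      case True
      then show thesis using cycle[of x d] d dcyc by simp
    next
      case False
      then consider a where "d = [a]" | a b where "d = [a, b]"
        using d(3) by (cases d; cases "tl d"; cases "tl (tl d)") auto
      then show thesis
      proof cases
        case 1
        have e: "{x, a} \<in> E" using dcyc 1 by simp
        show thesis
        proof (rule clique[of "{x, a}" x])
          show "card {x, a} \<in> {1, 2, 3}" using d(1) 1 by simp
          show "{u, v} \<in> E" if "u \<in> {x, a}" "v \<in> {x, a}" "u \<noteq> v" for u v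
            using that e by (auto simp: insert_commute)
        qed (use d(2) nbr_d 1 in auto)
      next
        case 2
        have e: "{x, a} \<in> E" "{a, b} \<in> E" "{b, x} \<in> E" using dcyc 2 by simp_all
        show thesis
        proof (rule clique[of "{x, a, b}" x])
          show "card {x, a, b} \<in> {1, 2, 3}" using d(1) 2 by simp
          show "{u, v} \<in> E" if "u \<in> {x, a, b}" "v \<in> {x, a, b}" "u \<noteq> v" for u v
            using that e by (auto simp: insert_commute)
        qed (use d(2) nbr_d 2 in auto)
      qed
    qed
  qed
qed

lemma card_signings_le:
  assumes "finite V" and loop: "\<And>v. {v} \<notin> E"
  shows "card (signings E V) \<le> max_signings (card V)"
  using \<open>finite V\<close>
proof (induction V rule: finite_psubset_induct)
  case (psubset V)
  have remove: "card (signings E V) \<le> max_signings (card V)"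
    if R: "R \<subseteq> V" "R \<noteq> {}" and pat: "card (boundary_patterns E V R) \<le> max_signings (card R)" for R
  proof -
    have "card (signings E V) \<le> card (boundary_patterns E V R) * card (signings E (V - R))"
      using psubset.hyps R(1) by (rule card_signings_le_mult)
    also have "\<dots> \<le> max_signings (card R) * max_signings (card (V - R))"
      using pat psubset.IH[of "V - R"] R by (intro mult_le_mono) auto
    also have "\<dots> \<le> max_signings (card R + card (V - R))" by (rule max_signings_supermult)
    also have "card R + card (V - R) = card V"
      using R psubset.hyps by (metis card_Diff_subset card_mono finite_subset le_add_diff_inverse)
    finally show ?thesis .
  qed
  show ?case
  proof (cases "V = {}")
    case True then show ?thesis by (simp add: signings_empty)
  next
    case False
    from psubset.hyps False loop show ?thesis
    proof (cases rule: clique_or_cycle)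
      case (clique R x)
      have "finite R" using clique(1) psubset.hyps by (rule finite_subset)
      have "card (boundary_patterns E V R) \<le> 2 * (2 ^ card R - 1)"
        using \<open>finite R\<close> clique(3-5) by (rule card_boundary_patterns_clique)
      also have "\<dots> = max_signings (card R)" using clique(2) by (auto simp: eval_nat_numeral)
      finally show ?thesis using remove clique by blast
    next
      case (cycle x c)
      have "card (boundary_patterns E V (set (x # c))) \<le> (\<Sum>a\<in>{-1, 0, 1}. sign_walks (length c) a a)"
        using cycle(1,4) by (rule card_boundary_patterns_cycle)
      also have "\<dots> \<le> max_signings (length c - 3 + 4)"
        using closed_walks_le[of "length c - 3"] cycle(3) by simp
      also have "length c - 3 + 4 = card (set (x # c))"
        using cycle(1,3) distinct_card[OF cycle(1)] by simp
      finally show ?thesis using remove[of "set (x # c)"] cycle(2) by simp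
    qed
  qed
qed

section \<open>Numerical estimates\<close>

lemma max_signings_even: "max_signings (2 * k) = 6 ^ k"
proof (induction k)
  case (Suc k)
  show ?case
  proof (cases k)
    case (Suc j)
    have "max_signings (2 * Suc k) = 6 * max_signings (2 * k)" using Suc by simp
    then show ?thesis using \<open>max_signings (2 * k) = 6 ^ k\<close> by simp
  qed (simp add: eval_nat_numeral)
qed simp

lemma max_signings_odd: "max_signings (2 * k + 3) = 14 * 6 ^ k"
proof (induction k)
  case (Suc k)
  have "max_signings (2 * Suc k + 3) = 6 * max_signings (2 * k + 3)"
    by (simp add: numeral_3_eq_3)
  then show ?case using Suc by simp
qed (simp add: numeral_3_eq_3)

lemma max_signings_ge_pow2: "3 * 2 ^ (n + 7) \<le> 2 * max_signings (n + 6)"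
proof (induction n rule: nat_induct2)
  case 0
  show ?case using max_signings_even[of 3] by simp
next
  case 1
  show ?case using max_signings_odd[of 2] by simp
next
  case (step n)
  have "max_signings (n + 2 + 6) = 6 * max_signings (n + 6)"
    using max_signings.simps(5)[of "n + 4"] by (simp add: eval_nat_numeral)
  moreover have "(2::nat) ^ (n + 2 + 7) = 4 * 2 ^ (n + 7)" by (simp add: power_add)
  ultimately show ?case using step by linarith
qed

lemma max_signings_two_side: "max_signings (Suc n) + 2 * 2 ^ Suc n \<le> max_signings (Suc (Suc n))"
proof (induction n rule: max_signings.induct)
  case (5 n)
  then show ?case by simp
qed simp_all

text \<open>For \<open>a = 1\<close> both sides agree, and for \<open>a = 2\<close> the right side grows fast enough. If
\<open>a, b \<ge> 3\<close>, each of \<open>max_signings a\<close> and \<open>max_signings b\<close> is at most a sixth of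
\<open>max_signings (a + b - 1)\<close>, and the remaining two thirds are at least \<open>2 ^ (a + b)\<close> as soon as
\<open>a + b \<ge> 7\<close>; the pair \<open>(3, 3)\<close> is computed.\<close>

lemma join_bound_numeric:
  assumes "a \<ge> 1" "b \<ge> 1"
  shows "max_signings a + max_signings b + (2 ^ a - 2) * (2 ^ b - 2) \<le> max_signings (a + b - 1) + 2"
  using assms
proof (induction a b rule: linorder_wlog)
  case (sym a b)
  then show ?case by (simp add: ac_simps)
next
  case (le a b)
  have pow2: "(2::nat) \<le> 2 ^ k" if "k \<ge> 1" for k using power_increasing[OF that, of "2::nat"] by simp
  consider "a = 1" | "a = 2" | "a = 3" "b = 3" | "a \<ge> 3" "b \<ge> 3" "a + b \<ge> 7" using le by linarith
  then show ?case
  proof cases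
    case 1 then show ?thesis by simp
  next
    case 2
    then obtain k where k: "b = Suc k" using le by (cases b) auto
    then show ?thesis using 2 max_signings_two_side[of k] pow2[of b] le(3)
      by (simp add: eval_nat_numeral)
  next
    case 3 then show ?thesis by (simp add: eval_nat_numeral)
  next
    case 4
    have side: "6 * max_signings c \<le> max_signings (c + d - 1)" if "d \<ge> 3" for c d
    proof -
      have "(6 :: nat) \<le> max_signings (Suc (Suc k))" for k
        by (induction k rule: max_signings.induct) auto
      moreover have "Suc (Suc (d - 3)) = d - 1" using that by simp
      ultimately have "6 \<le> max_signings (d - 1)" by metis
      then have "6 * max_signings c \<le> max_signings (d - 1) * max_signings c" by simp
      also have "\<dots> \<le> max_signings (d - 1 + c)" by (rule max_signings_supermult)
      finally show ?thesis using that by (simp add: ac_simps)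
    qed
    have "3 * 2 ^ (a + b) \<le> 2 * max_signings (a + b - 1)"
      using max_signings_ge_pow2[of "a + b - 7"] 4 by simp
    moreover have "6 * max_signings a \<le> max_signings (a + b - 1)" "6 * max_signings b \<le> max_signings (a + b - 1)"
      using side[of b a] side[of a b] 4 by (simp_all add: ac_simps)
    moreover have "(2 ^ a - 2) * (2 ^ b - 2) \<le> (2 ^ a * 2 ^ b :: nat)" by (intro mult_le_mono) auto
    ultimately show ?thesis unfolding power_add by linarith
  qed
qed

text \<open>With \<open>a \<le> b\<close> and \<open>d = n div 2 - a\<close>, dividing by \<open>2 ^ a\<close> leaves an inequality in
\<open>x = 2 ^ d\<close>: either \<open>(x - 1)\<^sup>2 \<ge> 0\<close> or \<open>(2 * x - 1) * (x - 1) \<ge> 0\<close>.\<close>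

lemma pow2_sum_ge:
  assumes "a + b = n"
  shows "even n \<Longrightarrow> 2 ^ (n div 2 + 1) \<le> (2 ^ a + 2 ^ b :: nat)"
    and "odd n \<Longrightarrow> 3 * 2 ^ (n div 2) \<le> (2 ^ a + 2 ^ b :: nat)"
proof -
  have gap: "2 * x \<le> 1 + x * x" "3 * x \<le> 1 + 2 * (x * x)" for x :: nat
  proof -
    have "0 \<le> (int x - 1) * (int x - 1)" by simp
    then have "2 * int x \<le> 1 + int x * int x" by (simp add: algebra_simps)
    then show "2 * x \<le> 1 + x * x" by (simp flip: of_nat_mult of_nat_add)
    show "3 * x \<le> 1 + 2 * (x * x)"
    proof (cases x)
      case (Suc y) then show ?thesis by (simp add: algebra_simps)
    qed simp
  qed
  have sq: "2 ^ (2 * d) = 2 ^ d * (2 ^ d :: nat)" for d by (simp add: mult_2 power_add)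
  have main: "(even n \<longrightarrow> 2 ^ (n div 2 + 1) \<le> (2 ^ a + 2 ^ b :: nat)) \<and>
      (odd n \<longrightarrow> 3 * 2 ^ (n div 2) \<le> (2 ^ a + 2 ^ b :: nat))"
    if "a \<le> b" "a + b = n" for a b
  proof (intro conjI impI)
    assume "even n"
    define d where "d = n div 2 - a"
    have d: "n div 2 = a + d" "b = a + 2 * d"
      using that \<open>even n\<close> by (auto simp: d_def elim!: evenE)
    show "2 ^ (n div 2 + 1) \<le> (2 ^ a + 2 ^ b :: nat)"
      using mult_le_mono2[OF gap(1)[of "2 ^ d"], of "2 ^ a"] unfolding d
      by (simp add: power_add sq distrib_left mult.left_commute)
  next
    assume "odd n"
    define d where "d = n div 2 - a"
    have d: "n div 2 = a + d" "b = a + 2 * d + 1"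
      using that \<open>odd n\<close> by (auto simp: d_def elim!: oddE)
    show "3 * 2 ^ (n div 2) \<le> (2 ^ a + 2 ^ b :: nat)"
      using mult_le_mono2[OF gap(2)[of "2 ^ d"], of "2 ^ a"] unfolding d
      by (simp add: power_add sq distrib_left mult.left_commute)
  qed
  show "even n \<Longrightarrow> 2 ^ (n div 2 + 1) \<le> (2 ^ a + 2 ^ b :: nat)"
    and "odd n \<Longrightarrow> 3 * 2 ^ (n div 2) \<le> (2 ^ a + 2 ^ b :: nat)"
    using main[of a b] main[of b a] assms by (cases "a \<le> b"; simp add: ac_simps)+
qed

section \<open>Tight potentials of a join\<close>

text \<open>The cuts of the join whose two classes both meet each of the sides \<open>V\<close> and \<open>V'\<close>, as
\<open>0\<close>-\<open>1\<close> potentials.\<close>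

definition mixed_cuts :: "'a set \<Rightarrow> 'a set \<Rightarrow> ('a \<Rightarrow> int) set" where
  "mixed_cuts V V' = (\<lambda>(X, Y). indicator (X \<union> Y)) ` ((Pow V - {{}, V}) \<times> (Pow V' - {{}, V'}))"

text \<open>Up to an additive constant, a tight potential that is constant on both sides of a join arises from
a signing of either side; removing these two signings from one side makes representatives unique.\<close>

definition side_constants :: "'a set \<Rightarrow> ('a \<Rightarrow> int) set" where
  "side_constants W = {indicator W, \<lambda>v. - indicator W v}"

definition join_edges :: "'a set \<Rightarrow> 'a set set \<Rightarrow> 'a set \<Rightarrow> 'a set set \<Rightarrow> 'a set set" where
  "join_edges V E V' E' = E \<union> E' \<union> {{i, j} | i j. i \<in> V \<and> j \<in> V'}"

lemma join_edges_commute: "join_edges V E V' E' = join_edges V' E' V E"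
  by (auto simp: join_edges_def insert_commute)

text \<open>The nonzero vertices of \<open>V\<close> are tightly joined to all of \<open>V'\<close>, and each zero of \<open>V\<close>
is tightly joined to a nonzero neighbour.\<close>

lemma signing_imp_tight_potential:
  assumes EV: "\<And>e. e \<in> E \<Longrightarrow> e \<subseteq> V" and EV': "\<And>e. e \<in> E' \<Longrightarrow> e \<subseteq> V'"
    and disj: "V \<inter> V' = {}" and ne: "V \<noteq> {}" "V' \<noteq> {}"
    and f: "f \<in> signings E V"
  shows "tight_potential (join_edges V E V' E') (V \<union> V') (\<lambda>v. real_of_int (f v))"
proof -
  have vals: "f v \<in> {-1, 0, 1}" and out: "v \<notin> V \<Longrightarrow> f v = 0"
    and compat: "u \<in> V \<Longrightarrow> v \<in> V \<Longrightarrow> {u, v} \<in> E \<Longrightarrow> f u * f v \<noteq> -1"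
    and dom: "v \<in> V \<Longrightarrow> f v = 0 \<Longrightarrow> \<exists>u\<in>V. {u, v} \<in> E \<and> f u \<noteq> 0" for u v
    using f unfolding signings_def by blast+
  have out': "v \<in> V' \<Longrightarrow> f v = 0" for v using disj out by blast
  have bound: "f i - f j \<le> 1" if "{i, j} \<in> join_edges V E V' E'" for i j
  proof -
    have "{i, j} \<in> E \<or> i \<in> V' \<or> j \<in> V'"
      using that EV'[of "{i, j}"] by (auto simp: join_edges_def doubleton_eq_iff)
    then consider "{i, j} \<in> E" | "i \<in> V'" | "j \<in> V'" by blast
    then show ?thesis
    proof cases
      case 1
      then have "i \<in> V" "j \<in> V" using EV by auto
      with 1 show ?thesis using compat[of i j] vals[of i] vals[of j] by auto
    qed (use vals[of i] vals[of j] out' in auto)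
  qed
  have cut: "\<exists>i\<in>C. \<exists>j\<in>V \<union> V' - C. {i, j} \<in> join_edges V E V' E' \<and> \<bar>f i - f j\<bar> = 1"
    if C: "C \<subseteq> V \<union> V'" "C \<noteq> {}" "C \<noteq> V \<union> V'" for C
  proof -
    let ?S = "{v \<in> V. f v \<noteq> 0}"
    let ?J = "join_edges V E V' E'"
    have tight: "\<bar>f i - f j\<bar> = 1 \<and> \<bar>f j - f i\<bar> = 1" if "f i \<noteq> 0" "f j = 0" for i j
      using vals[of i] that by auto
    have split: ?thesis
      if "i \<in> V \<union> V'" "j \<in> V \<union> V'" "{i, j} \<in> ?J" "f i \<noteq> 0" "f j = 0" "i \<in> C \<longleftrightarrow> j \<notin> C" for i j
    proof (cases "i \<in> C")
      case True then show ?thesis using that tight[of i j] by (intro bexI[of _ i] bexI[of _ j]) auto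
    next
      case False then show ?thesis using that tight[of i j]
        by (intro bexI[of _ j] bexI[of _ i]) (auto simp: insert_commute)
    qed
    obtain v where "v \<in> V" using ne by blast
    then obtain s where s: "s \<in> ?S" using dom[of v] by (cases "f v = 0") auto
    obtain w where w: "w \<in> V'" using ne by blast
    have cross: "{i, j} \<in> ?J" if "i \<in> V" "j \<in> V'" for i j
      using that by (auto simp: join_edges_def)
    show ?thesis
    proof (cases "\<forall>i\<in>?S \<union> V'. i \<in> C \<longleftrightarrow> s \<in> C")
      case False
      then obtain i where i: "i \<in> ?S \<union> V'" "i \<in> C \<longleftrightarrow> s \<notin> C" by blast
      show ?thesis
      proof (cases "i \<in> V'")
        case True
        then show ?thesis using split[of s i] s i out' cross by auto
      next
        case False
        then have "i \<in> ?S" using i by blast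
        then show ?thesis using split[of s w] split[of i w] s i w out' cross by auto
      qed
    next
      case True
      obtain v where v: "v \<in> V \<union> V'" "v \<in> C \<longleftrightarrow> s \<notin> C" using C s by blast
      then have "v \<in> V" "f v = 0" using True by auto
      then obtain u where "u \<in> ?S" "{u, v} \<in> E" using dom by blast
      then show ?thesis using split[of u v] True v \<open>f v = 0\<close> by (auto simp: join_edges_def)
    qed
  qed
  have eq: "real_of_int (f i) - real_of_int (f j) = real_of_int (f i - f j)" for i j by simp
  show ?thesis
    unfolding tight_potential_def eq
    using bound cut by (simp flip: of_int_abs of_int_diff)
qed

text \<open>A difference of \<open>2\<close> on one side forces the other side to the value in between. Hence, if the potential
is constant on neither side, it takes two consecutive values on each side, and they are the same two
values. If it is constant on one side, the cut around a single vertex of the other side shows that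
a vertex at the same level has a tight neighbour on its own side.\<close>

lemma tight_potential_join_cases:
  assumes EV: "\<And>e. e \<in> E \<Longrightarrow> e \<subseteq> V" and EV': "\<And>e. e \<in> E' \<Longrightarrow> e \<subseteq> V'"
    and disj: "V \<inter> V' = {}" and ne: "V \<noteq> {}" "V' \<noteq> {}"
    and h: "tight_potential (join_edges V E V' E') (V \<union> V') h"
  obtains f c where "f \<in> signings E V \<union> (signings E' V' - side_constants V') \<union> mixed_cuts V V'"
    "\<And>v. v \<in> V \<union> V' \<Longrightarrow> h v = real_of_int (f v) + c"
proof -
  let ?J = "join_edges V E V' E'"
  obtain r where r: "r \<in> V'" using ne by blast
  have "h v - h r \<in> \<int>" if "v \<in> V \<union> V'" for v
  proof (rule tight_potential_induct[OF h, of r "\<lambda>v. h v - h r \<in> \<int>", OF _ _ that])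
    fix i j assume "\<bar>h i - h j\<bar> = 1" "h i - h r \<in> \<int>"
    then have "h i - h j \<in> \<int>" by (metis Ints_1 abs_eq_iff' Ints_minus minus_minus)
    then have "(h i - h r) - (h i - h j) \<in> \<int>" using \<open>h i - h r \<in> \<int>\<close> by (rule Ints_diff[rotated])
    then show "h j - h r \<in> \<int>" by simp
  qed (use r in auto)
  then have "\<exists>g. h v = real_of_int g + h r" if "v \<in> V \<union> V'" for v
    using that by (metis Ints_cases diff_add_cancel)
  then obtain g where g: "\<And>v. v \<in> V \<union> V' \<Longrightarrow> h v = real_of_int (g v) + h r" by metis
  have edge: "\<bar>g i - g j\<bar> \<le> 1" if "{i, j} \<in> ?J" "i \<in> V \<union> V'" "j \<in> V \<union> V'" for i j
  proof -
    have "h i - h j \<le> 1" "h j - h i \<le> 1"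
      using tight_potential_bound[OF h] that by (auto simp: insert_commute)
    then show ?thesis using g[OF that(2)] g[OF that(3)] by linarith
  qed
  have cross: "\<bar>g i - g j\<bar> \<le> 1" if "i \<in> V" "j \<in> V'" for i j
    by (rule edge) (use that in \<open>auto simp: join_edges_def\<close>)
  \<comment> \<open>Every vertex has a tight edge, by the cut \<open>{v}\<close>.\<close>
  have tight: "\<exists>j\<in>V \<union> V'. {v, j} \<in> ?J \<and> \<bar>g v - g j\<bar> = 1" if v: "v \<in> V \<union> V'" for v
  proof -
    obtain a b where "a \<in> V" "b \<in> V'" using ne by blast
    then have "a \<noteq> b" "a \<in> V \<union> V'" "b \<in> V \<union> V'" using disj by auto
    then have "{v} \<noteq> V \<union> V'" by (metis singletonD)
    then obtain j where j: "j \<in> V \<union> V' - {v}" "{v, j} \<in> ?J" "\<bar>h v - h j\<bar> = 1"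
      using tight_potential_cut[OF h, of "{v}"] v by auto
    have "h v - h j = real_of_int (g v - g j)" using g[OF v] g[of j] j by simp
    then have "real_of_int \<bar>g v - g j\<bar> = 1" using j(3) by simp
    then have "\<bar>g v - g j\<bar> = 1" by linarith
    then show ?thesis using j by blast
  qed
  \<comment> \<open>The two sides play the same role; \<open>A\<close> is the side where the potential may vary.\<close>
  have signing: "(\<lambda>v. if v \<in> A then g v - k else 0) \<in> signings F A"
    if sides: "(A = V \<and> B = V' \<and> F = E) \<or> (A = V' \<and> B = V \<and> F = E')" and const: "\<And>v. v \<in> B \<Longrightarrow> g v = k"
    for A B F k
  proof -
    let ?f = "\<lambda>v. if v \<in> A then g v - k else 0"
    have AB: "A \<inter> B = {}" "A \<union> B = V \<union> V'" "F \<subseteq> ?J" using sides disj by (auto simp: join_edges_def)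
    have J: "{u, v} \<in> F \<or> v \<in> B" if "{u, v} \<in> ?J" "u \<in> A" for u v
      using that sides disj EV[of "{u, v}"] EV'[of "{u, v}"]
      by (auto simp: join_edges_def doubleton_eq_iff)
    have near: "\<bar>g v - k\<bar> \<le> 1" if "v \<in> A" for v
    proof -
      obtain b where "b \<in> B" using sides ne by blast
      then show ?thesis using cross[of v b] cross[of b v] const[of b] sides that by auto
    qed
    have "?f u * ?f v \<noteq> -1" if "u \<in> A" "v \<in> A" "{u, v} \<in> F" for u v
    proof -
      have "\<bar>g u - g v\<bar> \<le> 1" using edge[of u v] that AB by blast
      moreover have "g u - k \<in> {-1, 0, 1}" "g v - k \<in> {-1, 0, 1}" using near[of u] near[of v] that by auto
      ultimately show ?thesis using that by auto
    qed
    moreover have "\<exists>u\<in>A. {u, v} \<in> F \<and> ?f u \<noteq> 0" if v: "v \<in> A" "?f v = 0" for v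
    proof -
      obtain j where j: "j \<in> V \<union> V'" "{v, j} \<in> ?J" "\<bar>g v - g j\<bar> = 1" using tight[of v] v AB by blast
      have "g v = k" using v by simp
      then have "j \<notin> B" using j const by auto
      then have "j \<in> A" "{v, j} \<in> F" using j AB J[of v j] v by auto
      then show ?thesis using j \<open>g v = k\<close> by (intro bexI[of _ j]) (auto simp: insert_commute)
    qed
    moreover have "?f v \<in> {-1, 0, 1}" for v using near[of v] by auto
    ultimately show ?thesis unfolding signings_def by auto
  qed
  consider (flat') k where "\<And>v. v \<in> V' \<Longrightarrow> g v = k"
    | (flat) k where "\<And>v. v \<in> V \<Longrightarrow> g v = k" "\<not> (\<exists>k. \<forall>v\<in>V'. g v = k)"
    | (neither) "\<not> (\<exists>k. \<forall>v\<in>V. g v = k)" "\<not> (\<exists>k. \<forall>v\<in>V'. g v = k)"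
    by blast
  then show thesis
  proof cases
    case flat'
    show thesis
    proof (rule that[of "\<lambda>v. if v \<in> V then g v - k else 0" "real_of_int k + h r"])
      show "(\<lambda>v. if v \<in> V then g v - k else 0)
          \<in> signings E V \<union> (signings E' V' - side_constants V') \<union> mixed_cuts V V'"
        using signing[of V V' E k] flat' by blast
      show "h v = real_of_int (if v \<in> V then g v - k else 0) + (real_of_int k + h r)"
        if v: "v \<in> V \<union> V'" for v
        using g[OF v] flat'[of v] v by auto
    qed
  next
    case flat
    let ?f = "\<lambda>v. if v \<in> V' then g v - k else 0"
    have "?f \<notin> side_constants V'"
    proof
      assume "?f \<in> side_constants V'"
      then have "(\<forall>v\<in>V'. ?f v = 1) \<or> (\<forall>v\<in>V'. ?f v = -1)"
        unfolding side_constants_def by (auto simp: fun_eq_iff indicator_def split: if_splits)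
      then have "(\<forall>v\<in>V'. g v = k + 1) \<or> (\<forall>v\<in>V'. g v = k - 1)" by fastforce
      then show False using flat(2) by blast
    qed
    moreover have "?f \<in> signings E' V'" using signing[of V' V E' k] flat(1) by blast
    ultimately have "?f \<in> signings E V \<union> (signings E' V' - side_constants V') \<union> mixed_cuts V V'"
      by blast
    then show thesis
    proof (rule that[of ?f "real_of_int k + h r"])
      show "h v = real_of_int (?f v) + (real_of_int k + h r)" if v: "v \<in> V \<union> V'" for v
        using g[OF v] flat(1)[of v] v by auto
    qed
  next
    case neither
    obtain a a' where a: "a \<in> V" "a' \<in> V" "g a < g a'"
      using neither(1) by (metis linorder_neqE)
    obtain b b' where b: "b \<in> V'" "b' \<in> V'" "g b < g b'"
      using neither(2) by (metis linorder_neqE)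
    have vals: "g v \<in> {g a, g a + 1}" if "v \<in> V \<union> V'" for v
      using that cross[OF a(1) b(1)] cross[OF a(1) b(2)] cross[OF a(2) b(1)] cross[OF a(2) b(2)]
        cross[of v b] cross[of v b'] cross[of a v] cross[of a' v] a b by auto
    let ?X = "{v \<in> V. g v = g a + 1}" and ?Y = "{v \<in> V'. g v = g a + 1}"
    have "a' \<in> ?X" "a \<in> V - ?X" using vals[of a'] a by auto
    then have "?X \<in> Pow V - {{}, V}" by blast
    moreover have "b' \<in> ?Y" "b \<in> V' - ?Y" using vals[of b] vals[of b'] b by auto
    then have "?Y \<in> Pow V' - {{}, V'}" by blast
    ultimately have XY: "(?X, ?Y) \<in> (Pow V - {{}, V}) \<times> (Pow V' - {{}, V'})" by (rule SigmaI)
    have "indicator (?X \<union> ?Y) \<in> mixed_cuts V V'"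
      unfolding mixed_cuts_def by (rule image_eqI[OF _ XY]) simp
    moreover have "h v = real_of_int (indicator (?X \<union> ?Y) v) + (real_of_int (g a) + h r)"
      if "v \<in> V \<union> V'" for v
      using vals[OF that] g[OF that] that by (auto simp: indicator_def)
    ultimately show thesis
      using that[of "indicator (?X \<union> ?Y)" "real_of_int (g a) + h r"] by blast
  qed
qed

lemma tight_face_shift:
  assumes "\<And>e. e \<in> E \<Longrightarrow> e \<subseteq> V" "\<And>v. v \<in> V \<Longrightarrow> h v = g v + c"
  shows "tight_face E h = tight_face E g"
proof -
  have "h i - h j = g i - g j" if "{i, j} \<in> E" for i j
    using assms(1)[OF that] assms(2) by simp
  then have "{axis i 1 - axis j 1 :: real^'a | i j. {i, j} \<in> E \<and> h i - h j = 1}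
      = {axis i 1 - axis j 1 | i j. {i, j} \<in> E \<and> g i - g j = 1}" by metis
  then show ?thesis by (simp add: tight_face_def)
qed

lemma side_constants_signings:
  assumes "V \<noteq> {}"
  shows "side_constants V \<subseteq> signings E V" "card (side_constants V :: ('a \<Rightarrow> int) set) = 2"
proof -
  show "side_constants V \<subseteq> signings E V"
    by (auto simp: side_constants_def signings_def indicator_def)
  obtain v where "v \<in> V" using assms by blast
  then have "(indicator V v :: int) \<noteq> - indicator V v" by simp
  then have "(indicator V :: 'a \<Rightarrow> int) \<noteq> (\<lambda>v. - indicator V v)" by metis
  then show "card (side_constants V :: ('a \<Rightarrow> int) set) = 2" by (simp add: side_constants_def)
qed

lemma signing_const_imp_side_constants:
  assumes f: "f \<in> signings E V" and "V \<noteq> {}" and const: "\<And>v. v \<in> V \<Longrightarrow> f v = c"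
  shows "f \<in> side_constants V"
proof -
  obtain v where v: "v \<in> V" using assms by blast
  have "c \<noteq> 0"
  proof
    assume "c = 0"
    then obtain u where "u \<in> V" "f u \<noteq> 0" using f v const[OF v] unfolding signings_def by blast
    then show False using const \<open>c = 0\<close> by simp
  qed
  moreover have "c \<in> {-1, 0, 1}" using f const[OF v] unfolding signings_def by blast
  moreover have "f = (\<lambda>v. c * indicator V v)"
  proof
    fix v show "f v = c * indicator V v"
      using f const[of v] unfolding signings_def by (cases "v \<in> V") auto
  qed
  ultimately show ?thesis by (auto simp: side_constants_def)
qed

section \<open>Counting the facets of a join\<close>

text \<open>Distinct signings give distinct facets because each is pinned to \<open>0\<close> on the opposite side; only the
two signings that are constant on \<open>V'\<close> coincide, up to a constant, with signings of \<open>V\<close>.\<close>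

theorem num_facets_join_bounds:
  fixes V V' :: "'a::finite set"
  assumes EV: "\<And>e. e \<in> E \<Longrightarrow> e \<subseteq> V" and EV': "\<And>e. e \<in> E' \<Longrightarrow> e \<subseteq> V'"
    and disj: "V \<inter> V' = {}" and ne: "V \<noteq> {}" "V' \<noteq> {}"
  shows "card (signings E V) + card (signings E' V') \<le>
      num_facets (symmetric_edge_polytope (graph_join (V, E) (V', E'))) + 2"
    and "num_facets (symmetric_edge_polytope (graph_join (V, E) (V', E'))) + 2
      \<le> card (signings E V) + card (signings E' V') + (2 ^ card V - 2) * (2 ^ card V' - 2)"
proof -
  let ?J = "join_edges V E V' E'" and ?U = "V \<union> V'"
  let ?P = "symmetric_edge_polytope (?U, ?J)"
  let ?F = "\<lambda>f :: 'a \<Rightarrow> int. tight_face ?J (\<lambda>v. real_of_int (f v))"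
  let ?I = "signings E V" and ?I' = "signings E' V' - side_constants V'"
  have join: "graph_join (V, E) (V', E') = (?U, ?J)" by (simp add: graph_join_def join_edges_def)
  have JU: "e \<subseteq> ?U" if "e \<in> ?J" for e using that EV EV' by (auto simp: join_edges_def)
  obtain s t where st: "s \<in> V" "t \<in> V'" using ne by blast
  then have "s \<noteq> t" "{s, t} \<in> ?J" using disj by (auto simp: join_edges_def)
  have conn: "\<exists>i\<in>C. \<exists>j\<in>?U - C. {i, j} \<in> ?J" if C: "C \<subseteq> ?U" "C \<noteq> {}" "C \<noteq> ?U" for C
  proof (rule ccontr)
    assume no: "\<not> ?thesis"
    have same: "i \<in> C \<longleftrightarrow> j \<in> C" if "i \<in> V" "j \<in> V'" for i j
    proof -
      have "{i, j} \<in> ?J" "{j, i} \<in> ?J" using that by (auto simp: join_edges_def insert_commute)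
      then show ?thesis using no that by blast
    qed
    then have "v \<in> C \<longleftrightarrow> s \<in> C" if "v \<in> ?U" for v using that st by blast
    then show False using C by blast
  qed
  have fin: "finite ?I" "finite (signings E' V')" by (simp_all add: finite_signings)
  have disjI: "?I \<inter> ?I' = {}"
  proof (rule ccontr)
    assume "?I \<inter> ?I' \<noteq> {}"
    then obtain f where f: "f \<in> signings E V" "f \<in> signings E' V'" by blast
    have "f v = 0" if "v \<in> V" for v using f(2) disj that unfolding signings_def by blast
    then have "f \<in> side_constants V" using f(1) ne(1) by (rule signing_const_imp_side_constants[rotated 2])
    then have "f s \<noteq> 0" using st by (auto simp: side_constants_def)
    then show False using f(2) disj st unfolding signings_def by blast
  qed
  have cardI': "card ?I' + 2 = card (signings E' V')"
    using side_constants_signings(1)[OF ne(2), of E'] side_constants_signings(2)[OF ne(2)] card_mono[OF fin(2), of "side_constants V'"]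
    by (simp add: card_Diff_subset finite_subset[OF _ fin(2)])
  have tp: "tight_potential ?J ?U (\<lambda>v. real_of_int (f v))" if "f \<in> ?I \<union> ?I'" for f
    using that
  proof
    assume "f \<in> ?I" then show ?thesis using signing_imp_tight_potential[of E V E' V' f] EV EV' disj ne by blast
  next
    assume "f \<in> ?I'"
    then have "tight_potential (join_edges V' E' V E) (V' \<union> V) (\<lambda>v. real_of_int (f v))"
      using signing_imp_tight_potential[of E' V' E V f] EV EV' disj ne by blast
    then show ?thesis by (simp add: join_edges_commute Un_commute)
  qed
  have inj: "inj_on ?F (?I \<union> ?I')"
  proof (rule inj_onI)
    fix f g assume fg: "f \<in> ?I \<union> ?I'" "g \<in> ?I \<union> ?I'" and eq: "?F f = ?F g"
    have shift: "g v - f v = g u - f u" if "u \<in> ?U" "v \<in> ?U" for u v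
    proof -
      have "real_of_int (g v) - real_of_int (f v) = real_of_int (g u) - real_of_int (f u)"
        using tight_face_inj[OF tp[OF fg(1)] tp[OF fg(2)] eq that] .
      then show ?thesis by linarith
    qed
    have out: "f v = 0" if "f \<in> signings F W" "v \<notin> W" for f F W and v :: 'a
      using that unfolding signings_def by blast
    have mixed: False if f: "f \<in> ?I" and g: "g \<in> ?I'"
      and shift: "\<And>u v. u \<in> ?U \<Longrightarrow> v \<in> ?U \<Longrightarrow> g v - f v = g u - f u" for f g
    proof -
      have "g v = g t" if "v \<in> V'" for v
      proof -
        have "v \<notin> V" "t \<notin> V" using that st disj by auto
        then show ?thesis using shift[of v t] out[OF f] that st by auto
      qed
      then show False using g signing_const_imp_side_constants[of g E' V'] ne by blast
    qed
    consider "f \<in> ?I" "g \<in> ?I" | "f \<in> ?I'" "g \<in> ?I'" | "f \<in> ?I" "g \<in> ?I'" | "g \<in> ?I" "f \<in> ?I'"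
      using fg by blast
    then show "f = g"
    proof cases
      case 1
      have "t \<notin> V" using st disj by blast
      then have "f v = g v" for v
        using out[OF 1(1)] out[OF 1(2)] shift[of t v] st by (cases "v \<in> V") auto
      then show ?thesis by blast
    next
      case 2
      have "s \<notin> V'" using st disj by blast
      then have "f v = g v" for v
        using out[of f E' V'] out[of g E' V'] 2 shift[of s v] st by (cases "v \<in> V'") auto
      then show ?thesis by blast
    next
      case 3 then show ?thesis using mixed shift by blast
    next
      case 4
      have "f v - g v = f u - g u" if "u \<in> ?U" "v \<in> ?U" for u v using shift[OF that] by linarith
      then show ?thesis using mixed 4 by blast
    qed
  qed
  have "polyhedron ?P"
    unfolding symmetric_edge_polytope_def
    by (rule polyhedron_convex_hull, rule finite_subset[of _ "(\<lambda>(i, j). axis i 1 - axis j 1) ` UNIV"]) auto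
  then have finF: "finite {F. F facet_of ?P}" by (rule finite_polyhedron_facets)
  have "?F ` (?I \<union> ?I') \<subseteq> {F. F facet_of ?P}"
    using tight_potential_imp_facet[OF tp JU, of _ s t] st \<open>s \<noteq> t\<close> by blast
  then have "card (?I \<union> ?I') \<le> num_facets ?P"
    unfolding num_facets_def using card_inj_on_le[OF inj _ finF] by blast
  moreover have cardII: "card (?I \<union> ?I') + 2 = card ?I + card (signings E' V')"
    using card_Un_disjoint[OF fin(1) _ disjI] fin(2) cardI' by simp
  ultimately show "card ?I + card (signings E' V') \<le> num_facets (symmetric_edge_polytope (graph_join (V, E) (V', E'))) + 2"
    unfolding join by simp
  have finM: "finite (mixed_cuts V V')" by (simp add: mixed_cuts_def)
  have "{F. F facet_of ?P} \<subseteq> ?F ` (?I \<union> ?I' \<union> mixed_cuts V V')"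
  proof clarify
    fix F assume "F facet_of ?P"
    then obtain h where h: "tight_potential ?J ?U h" "F = tight_face ?J h"
      using facet_imp_tight_potential[OF _ JU conn \<open>{s, t} \<in> ?J\<close>] by blast
    obtain f c where f: "f \<in> ?I \<union> ?I' \<union> mixed_cuts V V'" "\<And>v. v \<in> ?U \<Longrightarrow> h v = real_of_int (f v) + c"
      using tight_potential_join_cases[OF EV EV' disj ne h(1)] by metis
    then have "F = ?F f" unfolding h(2) by (intro tight_face_shift[OF JU]) auto
    then show "F \<in> ?F ` (?I \<union> ?I' \<union> mixed_cuts V V')" using f(1) by blast
  qed
  then have "num_facets ?P \<le> card (?I \<union> ?I' \<union> mixed_cuts V V')"
    unfolding num_facets_def using fin finM by (intro surj_card_le) auto
  also have "\<dots> \<le> card (?I \<union> ?I') + card (mixed_cuts V V')" by (rule card_Un_le)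
  finally have "num_facets ?P + 2 \<le> card ?I + card (signings E' V') + card (mixed_cuts V V')"
    using cardII by simp
  moreover have "card (mixed_cuts V V') \<le> (2 ^ card V - 2) * (2 ^ card V' - 2)"
  proof -
    have *: "card (Pow W - {{}, W}) = 2 ^ card W - 2" if "W \<noteq> {}" for W :: "'a set"
      using that by (subst card_Diff_subset) (auto simp: card_Pow)
    have "card (mixed_cuts V V') \<le> card ((Pow V - {{}, V}) \<times> (Pow V' - {{}, V'}))"
      unfolding mixed_cuts_def by (rule card_image_le) simp
    then show ?thesis by (simp add: card_cartesian_product * ne)
  qed
  ultimately show "num_facets (symmetric_edge_polytope (graph_join (V, E) (V', E'))) + 2
      \<le> card ?I + card (signings E' V') + (2 ^ card V - 2) * (2 ^ card V' - 2)"
    unfolding join by linarith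
qed

text \<open>The bound \<open>max_signings (n - 1)\<close> is \<open>6 ^ k\<close> for \<open>n = 2 * k + 1\<close> and \<open>14 * 6 ^ j\<close> for
\<open>n = 2 * j + 4\<close>. The case \<open>n = 2\<close> is separate: there the bound \<open>2\<close> is smaller than
\<open>14 / 6\<close>.\<close>

theorem theorem1p4:
  fixes V V' :: "'a::finite set" and E E' :: "'a set set" and n :: nat
  assumes "simple_graph (V, E)" and "simple_graph (V', E')"
    and "V \<noteq> {}" and "V' \<noteq> {}" and "V \<inter> V' = {}"
    and "n = card V + card V'"
  shows "(odd n \<longrightarrow>
            3 * 2 powr ((real n - 1) / 2) - 2
              \<le> real (num_facets (symmetric_edge_polytope (graph_join (V, E) (V', E'))))
          \<and> real (num_facets (symmetric_edge_polytope (graph_join (V, E) (V', E'))))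
              \<le> 6 powr ((real n - 1) / 2))
       \<and> (even n \<longrightarrow>
            2 powr (real n / 2 + 1) - 2
              \<le> real (num_facets (symmetric_edge_polytope (graph_join (V, E) (V', E'))))
          \<and> real (num_facets (symmetric_edge_polytope (graph_join (V, E) (V', E'))))
              \<le> 14 * 6 powr (real n / 2 - 2))"
proof -
  let ?N = "num_facets (symmetric_edge_polytope (graph_join (V, E) (V', E')))"
  let ?a = "card V" and ?b = "card V'"
  have E: "\<forall>e\<in>E. e \<subseteq> V \<and> card e = 2" and E': "\<forall>e\<in>E'. e \<subseteq> V' \<and> card e = 2"
    using assms(1,2) by (simp_all add: simple_graph_def)
  have sub: "e \<in> E \<Longrightarrow> e \<subseteq> V" "e \<in> E' \<Longrightarrow> e \<subseteq> V'" for e using E E' by blast+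
  have loop: "{v} \<notin> E" "{v} \<notin> E'" for v using E E' by fastforce+
  have pos: "?a \<ge> 1" "?b \<ge> 1" using assms(3,4) by (simp_all add: Suc_le_eq card_gt_0_iff)
  note bounds = num_facets_join_bounds[of E V E' V', OF sub assms(5,3,4)]
  have "2 ^ ?a + 2 ^ ?b \<le> ?N + 2"
    using bounds(1) card_signings_ge[of V E] card_signings_ge[of V' E'] by simp
  then have lower: "odd n \<Longrightarrow> 3 * 2 ^ (n div 2) \<le> ?N + 2" "even n \<Longrightarrow> 2 ^ (n div 2 + 1) \<le> ?N + 2"
    using pow2_sum_ge[OF assms(6)[symmetric]] by linarith+
  have upper: "?N \<le> max_signings (n - 1)"
    using bounds(2) card_signings_le[of V E, OF _ loop(1)] card_signings_le[of V' E', OF _ loop(2)]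
      join_bound_numeric[OF pos] unfolding assms(6) by simp
  show ?thesis
  proof (intro conjI impI)
    assume "odd n"
    then obtain k where k: "n = 2 * k + 1" by (elim oddE)
    have e: "(real n - 1) / 2 = real k" by (simp add: k)
    have "3 * 2 ^ k \<le> ?N + 2" using lower(1)[OF \<open>odd n\<close>] by (simp add: k)
    then have "real (3 * 2 ^ k) \<le> real (?N + 2)" by (rule of_nat_mono)
    then show "3 * 2 powr ((real n - 1) / 2) - 2 \<le> real ?N"
      unfolding e by (simp add: powr_realpow)
    have "?N \<le> 6 ^ k" using upper by (simp add: k max_signings_even)
    then have "real ?N \<le> real (6 ^ k)" by (rule of_nat_mono)
    then show "real ?N \<le> 6 powr ((real n - 1) / 2)"
      unfolding e by (simp add: powr_realpow)
  next
    assume "even n"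
    then obtain k where k: "n = 2 * k" by (elim evenE)
    have e: "real n / 2 + 1 = real (k + 1)" by (simp add: k)
    have "2 ^ (k + 1) \<le> ?N + 2" using lower(2)[OF \<open>even n\<close>] by (simp add: k)
    then have "real (2 ^ (k + 1)) \<le> real (?N + 2)" by (rule of_nat_mono)
    then show "2 powr (real n / 2 + 1) - 2 \<le> real ?N"
      unfolding e by (subst powr_realpow) simp_all
    show "real ?N \<le> 14 * 6 powr (real n / 2 - 2)"
    proof (cases "k = 1")
      case True
      then have "real n / 2 - 2 = - 1" "real ?N \<le> 2" using upper by (simp_all add: k)
      then show ?thesis by (simp add: powr_minus)
    next
      case False
      then have "k \<ge> 2" using pos assms(6) k by linarith
      then obtain j where j: "k = j + 2" by (metis add.commute le_iff_add)
      have e': "real n / 2 - 2 = real j" by (simp add: k j field_simps)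
      have "n - 1 = 2 * j + 3" by (simp add: k j)
      then have "?N \<le> 14 * 6 ^ j" using upper by (simp add: max_signings_odd)
      then have "real ?N \<le> real (14 * 6 ^ j)" by (rule of_nat_mono)
      then show ?thesis unfolding e' by (simp add: powr_realpow)
    qed
  qed
qed

end
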